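(* Let $J=(J_{ij})$ be a real symmetric $3\times3$ matrix. The discrete Suslov system $$M_{k+1}=\Omega_k^TM_k\Omega_k+\lambda_k\begin{pmatrix}0&1&0\\-1&0&0\\0&0&0\end{pmatrix},\qquad M_k=\Omega_kJ-J\Omega_k^T,$$ where all $\Omega_k$ belong to the admissible set $\mathcal S\subset SO(3)$ and $\lambda_k\in\mathbb R$ are multipliers, has the quadratic integral $$(J_{11}+J_{33})M_1^2+2J_{12}M_1M_2+(J_{22}+J_{33})M_2^2,$$ i.e. this function of $\overrightarrow{M_k}=(M_1,M_2,M_3)^T$ takes the same value at $\overrightarrow{M_k}$ and $\overrightarrow{M_{k+1}}$. In terms of the parameters $q_0,q_1,q_2$ of $\Omega_k$ it gives rise (up to a constant factor) to the quartic integral $$H=\big((J_{22}+J_{33})q_1^2-2J_{12}q_1q_2+(J_{11}+J_{33})q_2^2\big)\cdot\Big((J_{13}q_1+J_{23}q_2)^2+\big[(J_{11}+J_{33})(J_{22}+J_{33})-J_{12}^2\big]q_0^2\Big).$$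
   Context: The set $\mathcal S$ of admissible rotation matrices consists of the matrices $$\Omega=\begin{pmatrix}2(q_0^2+q_1^2)-1&2q_1q_2&2q_0q_2\\2q_1q_2&2(q_0^2+q_2^2)-1&-2q_0q_1\\-2q_0q_2&2q_0q_1&2q_0^2-1\end{pmatrix},\qquad q_0^2+q_1^2+q_2^2=1,$$ where $(q_0,q_1,q_2)$ and $-(q_0,q_1,q_2)$ give the same matrix. A skew-symmetric $3\times3$ matrix $M=(M_{ij})$ is identified with the vector $\overrightarrow M=(M_1,M_2,M_3)^T$, $M_1=-M_{23}$, $M_2=M_{13}$, $M_3=-M_{12}$. The system defines a (generally multi-valued) map $M_k\mapsto M_{k+1}$, equivalently $\Omega_k\mapsto\Omega_{k+1}$; an integral is a function constant along every sequence satisfying the system. *)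

theory Defs
  imports "HOL-Analysis.Analysis"
begin

definition rotation_of :: "real \<Rightarrow> real \<Rightarrow> real \<Rightarrow> real^3^3" where
  "rotation_of q0 q1 q2 = vector
     [vector [2 * (q0\<^sup>2 + q1\<^sup>2) - 1, 2 * q1 * q2, 2 * q0 * q2],
      vector [2 * q1 * q2, 2 * (q0\<^sup>2 + q2\<^sup>2) - 1, - 2 * q0 * q1],
      vector [- 2 * q0 * q2, 2 * q0 * q1, 2 * q0\<^sup>2 - 1]]"

definition admissible :: "(real^3^3) set" where
  "admissible = {rotation_of q0 q1 q2 | q0 q1 q2. q0\<^sup>2 + q1\<^sup>2 + q2\<^sup>2 = 1}"

definition skew_vec :: "real^3^3 \<Rightarrow> real^3" where
  "skew_vec M = vector [- (M $ 2 $ 3), M $ 1 $ 3, - (M $ 1 $ 2)]"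

definition constraint_matrix :: "real^3^3" where
  "constraint_matrix = vector [vector [0, 1, 0], vector [-1, 0, 0], vector [0, 0, 0]]"

text \<open>The time set \<open>I\<close> is an arbitrary set of consecutive integers, since the system defines only a
  multi-valued map and an orbit need not extend indefinitely in either direction. Two-point sets
  \<open>{k, k+1}\<close> give single steps, \<open>UNIV\<close> gives bi-infinite orbits.\<close>

definition suslov_solution ::
  "real^3^3 \<Rightarrow> int set \<Rightarrow> (int \<Rightarrow> real^3^3) \<Rightarrow> (int \<Rightarrow> real^3^3) \<Rightarrow> (int \<Rightarrow> real) \<Rightarrow> bool" where
  "suslov_solution J I \<Omega> M \<mu> \<longleftrightarrow>
     (\<forall>i\<in>I. \<forall>j\<in>I. {i..j} \<subseteq> I) \<and>
     (\<forall>k\<in>I. \<Omega> k \<in> admissible \<and> M k = \<Omega> k ** J - J ** transpose (\<Omega> k)) \<and>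
     (\<forall>k. k \<in> I \<and> k + 1 \<in> I \<longrightarrow>
        M (k + 1) = transpose (\<Omega> k) ** M k ** \<Omega> k + \<mu> k *\<^sub>R constraint_matrix)"

definition momentum_integral :: "real^3^3 \<Rightarrow> (real^3 \<Rightarrow> real) \<Rightarrow> bool" where
  "momentum_integral J F \<longleftrightarrow>
     (\<forall>I \<Omega> M \<mu>. suslov_solution J I \<Omega> M \<mu> \<longrightarrow>
        (\<forall>j\<in>I. \<forall>k\<in>I. F (skew_vec (M j)) = F (skew_vec (M k))))"

text \<open>The parameters of each \<open>\<Omega> k\<close> are determined only up to a common sign. The sign is chosen
  arbitrarily and independently at every time.\<close>

definition parameter_integral :: "real^3^3 \<Rightarrow> (real \<Rightarrow> real \<Rightarrow> real \<Rightarrow> real) \<Rightarrow> bool" where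
  "parameter_integral J G \<longleftrightarrow>
     (\<forall>I \<Omega> M \<mu> q0 q1 q2. suslov_solution J I \<Omega> M \<mu> \<and>
        (\<forall>k\<in>I. (q0 k)\<^sup>2 + (q1 k)\<^sup>2 + (q2 k)\<^sup>2 = 1 \<and> \<Omega> k = rotation_of (q0 k) (q1 k) (q2 k)) \<longrightarrow>
        (\<forall>j\<in>I. \<forall>k\<in>I. G (q0 j) (q1 j) (q2 j) = G (q0 k) (q1 k) (q2 k)))"

definition quadratic_form :: "real^3^3 \<Rightarrow> real^3 \<Rightarrow> real" where
  "quadratic_form J m =
     (J$1$1 + J$3$3) * (m$1)\<^sup>2 + 2 * J$1$2 * m$1 * m$2 + (J$2$2 + J$3$3) * (m$2)\<^sup>2"

definition quartic_H :: "real^3^3 \<Rightarrow> real \<Rightarrow> real \<Rightarrow> real \<Rightarrow> real" where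
  "quartic_H J q0 q1 q2 =
     ((J$2$2 + J$3$3) * q1\<^sup>2 - 2 * J$1$2 * q1 * q2 + (J$1$1 + J$3$3) * q2\<^sup>2) *
     ((J$1$3 * q1 + J$2$3 * q2)\<^sup>2
       + ((J$1$1 + J$3$3) * (J$2$2 + J$3$3) - (J$1$2)\<^sup>2) * q0\<^sup>2)"

end

theory Submission
  imports Defs
begin

text \<open>
  Write \<open>N\<close> for the symmetric \<open>2 \<times> 2\<close> matrix with rows \<open>(J\<^sub>1\<^sub>1 + J\<^sub>3\<^sub>3, J\<^sub>1\<^sub>2)\<close> and
  \<open>(J\<^sub>1\<^sub>2, J\<^sub>2\<^sub>2 + J\<^sub>3\<^sub>3)\<close>. The quadratic form is \<open>m \<bullet> N m\<close>, where \<open>m\<close> consists of the first two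
  components of the momentum. Put \<open>q = (q\<^sub>1, q\<^sub>2)\<close>, \<open>q\<^sup>\<bottom> = (- q\<^sub>2, q\<^sub>1)\<close> and
  \<open>s = J\<^sub>1\<^sub>3 q\<^sub>1 + J\<^sub>2\<^sub>3 q\<^sub>2\<close>. In terms of the parameters of the rotation,
  \<open>m = 2 (q\<^sub>0 adj N q + s q\<^sup>\<bottom>)\<close> (lemma \<open>suslov_momentum_components\<close>). The two summands are
  orthogonal for \<open>N\<close>, because \<open>q\<^sup>\<bottom> \<bullet> N (adj N q) = det N (q\<^sup>\<bottom> \<bullet> q) = 0\<close>, and their \<open>N\<close>-squares are
  both multiples of \<open>K = q \<bullet> adj N q\<close>, by the factors \<open>q\<^sub>0\<^sup>2 det N\<close> and \<open>s\<^sup>2\<close>. Hence the quadratic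
  form equals \<open>4 K (s\<^sup>2 + det N q\<^sub>0\<^sup>2)\<close>, which is four times the quartic \<open>H\<close>.

  The invariance rests on the fact that this expression is even in \<open>q\<^sub>0\<close>. The multiplier changes
  only the third momentum component, which the quadratic form ignores. Up to it, the next momentum
  is \<open>\<Omega>\<^sup>T (\<Omega> J - J \<Omega>\<^sup>T) \<Omega> = J \<Omega> - \<Omega>\<^sup>T J\<close>, the negative of the momentum that belongs to
  \<open>\<Omega>\<^sup>T\<close> in place of \<open>\<Omega>\<close>. Transposing an admissible rotation means replacing \<open>q\<^sub>0\<close> by \<open>- q\<^sub>0\<close>,
  so one step of the system preserves the value of the form.
\<close>

lemma rotation_of_entries:
  "rotation_of q0 q1 q2 $ 1 $ 1 = 2 * (q0\<^sup>2 + q1\<^sup>2) - 1"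
  "rotation_of q0 q1 q2 $ 1 $ 2 = 2 * q1 * q2"
  "rotation_of q0 q1 q2 $ 1 $ 3 = 2 * q0 * q2"
  "rotation_of q0 q1 q2 $ 2 $ 1 = 2 * q1 * q2"
  "rotation_of q0 q1 q2 $ 2 $ 2 = 2 * (q0\<^sup>2 + q2\<^sup>2) - 1"
  "rotation_of q0 q1 q2 $ 2 $ 3 = - 2 * q0 * q1"
  "rotation_of q0 q1 q2 $ 3 $ 1 = - 2 * q0 * q2"
  "rotation_of q0 q1 q2 $ 3 $ 2 = 2 * q0 * q1"
  "rotation_of q0 q1 q2 $ 3 $ 3 = 2 * q0\<^sup>2 - 1"
  by (simp_all add: rotation_of_def)

lemma transpose_rotation_of: "transpose (rotation_of q0 q1 q2) = rotation_of (- q0) q1 q2"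
  by (simp add: vec_eq_iff forall_3 transpose_def rotation_of_entries)

lemma rotation_of_orthogonal:
  assumes "q0\<^sup>2 + q1\<^sup>2 + q2\<^sup>2 = 1"
  shows "transpose (rotation_of q0 q1 q2) ** rotation_of q0 q1 q2 = mat 1"
  \<comment> \<open>Of the nine entries of the equation, some follow from the normalisation of the parameters and
    the others are polynomial identities.\<close>
  using assms unfolding transpose_rotation_of
  by (simp add: vec_eq_iff forall_3 matrix_matrix_mult_def sum_3 mat_def rotation_of_entries)
    (intro conjI; (algebra | simp add: algebra_simps power2_eq_square))

text \<open>The diagonal entries of the rotation enter these two components only through differences, in
  which the constants \<open>- 1\<close> cancel. The formulas are therefore polynomial identities in the
  parameters, homogeneous of degree two.\<close>

lemma suslov_momentum_components:
  fixes J :: "real^3^3"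
  defines "m q0 q1 q2 \<equiv> skew_vec (rotation_of q0 q1 q2 ** J - J ** transpose (rotation_of q0 q1 q2))"
  assumes J: "transpose J = J"
  shows "m q0 q1 q2 $ 1 =
           2 * (q0 * ((J$2$2 + J$3$3) * q1 - J$1$2 * q2) - (J$1$3 * q1 + J$2$3 * q2) * q2)"
    and "m q0 q1 q2 $ 2 =
           2 * (q0 * ((J$1$1 + J$3$3) * q2 - J$1$2 * q1) + (J$1$3 * q1 + J$2$3 * q2) * q1)"
proof -
  have sym: "J$j$i = J$i$j" for i j
    using arg_cong[OF J, of "\<lambda>A. A$i$j"] by (simp add: transpose_def)
  have J': "J$2$1 = J$1$2" "J$3$1 = J$1$3" "J$3$2 = J$2$3"
    by (rule sym)+
  show "m q0 q1 q2 $ 1 =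
           2 * (q0 * ((J$2$2 + J$3$3) * q1 - J$1$2 * q2) - (J$1$3 * q1 + J$2$3 * q2) * q2)"
    by (simp add: m_def skew_vec_def transpose_rotation_of matrix_matrix_mult_def sum_3
        rotation_of_entries J' power2_eq_square algebra_simps)
  show "m q0 q1 q2 $ 2 =
           2 * (q0 * ((J$1$1 + J$3$3) * q2 - J$1$2 * q1) + (J$1$3 * q1 + J$2$3 * q2) * q1)"
    by (simp add: m_def skew_vec_def transpose_rotation_of matrix_matrix_mult_def sum_3
        rotation_of_entries J' power2_eq_square algebra_simps)
qed

text \<open>The \<open>q\<^sub>0\<close>-linear terms cancel since \<open>adj N q\<close> and \<open>q\<^sup>\<bottom>\<close> are orthogonal for \<open>N\<close>. The
  factor \<open>4\<close> is the square of the factor \<open>2\<close> in the momentum.\<close>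

lemma quadratic_form_eq_quartic_H:
  assumes "transpose J = J"
  shows "quadratic_form J
           (skew_vec (rotation_of q0 q1 q2 ** J - J ** transpose (rotation_of q0 q1 q2)))
         = 4 * quartic_H J q0 q1 q2"
  unfolding quadratic_form_def quartic_H_def suslov_momentum_components[OF assms]
  by (simp add: power2_eq_square algebra_simps)

lemma quartic_H_even: "quartic_H J (- q0) q1 q2 = quartic_H J q0 q1 q2"
  by (simp add: quartic_H_def)

lemma quadratic_form_skew_vec_minus:
  "quadratic_form J (skew_vec (- A)) = quadratic_form J (skew_vec A)"
  by (simp add: quadratic_form_def skew_vec_def)

lemma quadratic_form_skew_vec_add_constraint:
  "quadratic_form J (skew_vec (A + c *\<^sub>R constraint_matrix)) = quadratic_form J (skew_vec A)"
  by (simp add: quadratic_form_def skew_vec_def constraint_matrix_def)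

lemma matrix_mult_diff_ldistrib: "A ** (B - C) = A ** B - A ** C"
  for A :: "'a::ring_1^'n^'m" and B C :: "'a^'p^'n"
  by (simp add: matrix_matrix_mult_def vec_eq_iff right_diff_distrib sum_subtractf)

lemma matrix_mult_diff_rdistrib: "(A - B) ** C = A ** C - B ** C"
  for A B :: "'a::ring_1^'n^'m" and C :: "'a^'p^'n"
  by (simp add: matrix_matrix_mult_def vec_eq_iff left_diff_distrib sum_subtractf)

lemma orthogonal_conjugate_momentum:
  fixes W J :: "real^'n^'n"
  assumes "transpose W ** W = mat 1"
  shows "transpose W ** (W ** J - J ** transpose W) ** W = - (transpose W ** J - J ** W)"
proof -
  have "transpose W ** (W ** J - J ** transpose W) ** W
      = (transpose W ** W) ** J ** W - transpose W ** J ** (transpose W ** W)"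
    by (simp add: matrix_mult_diff_ldistrib matrix_mult_diff_rdistrib matrix_mul_assoc)
  then show ?thesis
    by (simp add: assms)
qed

lemma quadratic_form_suslov_step:
  assumes J: "transpose J = J"
    and W: "W \<in> admissible"
  shows "quadratic_form J
           (skew_vec (transpose W ** (W ** J - J ** transpose W) ** W + c *\<^sub>R constraint_matrix))
         = quadratic_form J (skew_vec (W ** J - J ** transpose W))"
proof -
  obtain q0 q1 q2 where q: "q0\<^sup>2 + q1\<^sup>2 + q2\<^sup>2 = 1" and W_eq: "W = rotation_of q0 q1 q2"
    using W unfolding admissible_def by blast
  have tW: "transpose W = rotation_of (- q0) q1 q2"
    by (simp add: W_eq transpose_rotation_of)
  have orth: "transpose W ** W = mat 1"
    unfolding W_eq by (rule rotation_of_orthogonal[OF q])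
  have "quadratic_form J
          (skew_vec (transpose W ** (W ** J - J ** transpose W) ** W + c *\<^sub>R constraint_matrix))
      = quadratic_form J (skew_vec (transpose W ** J - J ** transpose (transpose W)))"
    unfolding quadratic_form_skew_vec_add_constraint orthogonal_conjugate_momentum[OF orth]
      quadratic_form_skew_vec_minus transpose_transpose ..
  also have "\<dots> = 4 * quartic_H J (- q0) q1 q2"
    unfolding tW by (rule quadratic_form_eq_quartic_H[OF J])
  also have "\<dots> = quadratic_form J (skew_vec (W ** J - J ** transpose W))"
    using quadratic_form_eq_quartic_H[OF J] by (simp add: W_eq quartic_H_even)
  finally show ?thesis .
qed

lemma constant_on_consecutive_integers:
  fixes f :: "int \<Rightarrow> 'a"
  assumes interval: "\<forall>i\<in>I. \<forall>j\<in>I. {i..j} \<subseteq> I"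
    and step: "\<And>k. k \<in> I \<Longrightarrow> k + 1 \<in> I \<Longrightarrow> f (k + 1) = f k"
    and "j \<in> I" "k \<in> I"
  shows "f j = f k"
proof -
  have forward: "f b = f a" if "a \<le> b" "a \<in> I" "b \<in> I" for a b
    using that
  proof (induction b rule: int_ge_induct)
    case base
    show ?case by simp
  next
    case (step b)
    have "b \<in> {a..b + 1}"
      using step.hyps by simp
    then have "b \<in> I"
      using interval step.prems by blast
    then show ?case
      using step assms(2) by simp
  qed
  show ?thesis
    using forward[of j k] forward[of k j] assms(3,4) by (cases "j \<le> k") auto
qed

lemma momentum_integral_quadratic_form:
  assumes J: "transpose J = J"
  shows "momentum_integral J (quadratic_form J)"
  unfolding momentum_integral_def
proof (intro allI impI ballI)
  fix I \<Omega> M \<mu> and j k :: int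
  assume sol: "suslov_solution J I \<Omega> M \<mu>" and jk: "j \<in> I" "k \<in> I"
  have interval: "\<forall>i\<in>I. \<forall>j\<in>I. {i..j} \<subseteq> I"
    and M: "\<And>i. i \<in> I \<Longrightarrow> \<Omega> i \<in> admissible \<and> M i = \<Omega> i ** J - J ** transpose (\<Omega> i)"
    and next_M: "\<And>i. i \<in> I \<Longrightarrow> i + 1 \<in> I \<Longrightarrow>
      M (i + 1) = transpose (\<Omega> i) ** M i ** \<Omega> i + \<mu> i *\<^sub>R constraint_matrix"
    using sol unfolding suslov_solution_def by blast+
  have "quadratic_form J (skew_vec (M (i + 1))) = quadratic_form J (skew_vec (M i))"
    if i: "i \<in> I" "i + 1 \<in> I" for i
  proof -
    have "\<Omega> i \<in> admissible" and Mi: "M i = \<Omega> i ** J - J ** transpose (\<Omega> i)"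
      using M[OF i(1)] by blast+
    then show ?thesis
      unfolding next_M[OF i] Mi by (intro quadratic_form_suslov_step[OF J])
  qed
  from constant_on_consecutive_integers
    [where f = "\<lambda>i. quadratic_form J (skew_vec (M i))", OF interval this jk]
  show "quadratic_form J (skew_vec (M j)) = quadratic_form J (skew_vec (M k))" .
qed

lemma parameter_integral_quartic_H:
  assumes J: "transpose J = J"
  shows "parameter_integral J (quartic_H J)"
  unfolding parameter_integral_def
proof (intro allI impI ballI, elim conjE)
  fix I \<Omega> M \<mu> q0 q1 q2 and j k :: int
  assume sol: "suslov_solution J I \<Omega> M \<mu>" and jk: "j \<in> I" "k \<in> I"
    and param: "\<forall>k\<in>I. (q0 k)\<^sup>2 + (q1 k)\<^sup>2 + (q2 k)\<^sup>2 = 1 \<and> \<Omega> k = rotation_of (q0 k) (q1 k) (q2 k)"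
  have H: "quadratic_form J (skew_vec (M i)) = 4 * quartic_H J (q0 i) (q1 i) (q2 i)" if "i \<in> I" for i
  proof -
    have "M i = \<Omega> i ** J - J ** transpose (\<Omega> i)"
      using sol that unfolding suslov_solution_def by blast
    moreover have "\<Omega> i = rotation_of (q0 i) (q1 i) (q2 i)"
      using param that by blast
    ultimately show ?thesis
      using quadratic_form_eq_quartic_H[OF J] by simp
  qed
  have "quadratic_form J (skew_vec (M j)) = quadratic_form J (skew_vec (M k))"
    using momentum_integral_quadratic_form[OF J] sol jk unfolding momentum_integral_def by blast
  then show "quartic_H J (q0 j) (q1 j) (q2 j) = quartic_H J (q0 k) (q1 k) (q2 k)"
    using H jk by simp
qed

theorem theorem6p2:
  "\<exists>c::real. c \<noteq> 0 \<and>
     (\<forall>J::real^3^3. transpose J = J \<longrightarrow>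
        momentum_integral J (quadratic_form J) \<and>
        (\<forall>\<Omega> q0 q1 q2. q0\<^sup>2 + q1\<^sup>2 + q2\<^sup>2 = 1 \<and> \<Omega> = rotation_of q0 q1 q2 \<longrightarrow>
           quadratic_form J (skew_vec (\<Omega> ** J - J ** transpose \<Omega>)) = c * quartic_H J q0 q1 q2) \<and>
        parameter_integral J (quartic_H J))"
proof (intro exI[of _ 4] conjI allI impI)
  show "(4::real) \<noteq> 0" by simp
next
  fix J \<Omega> :: "real^3^3" and q0 q1 q2 :: real
  assume "transpose J = J" and "q0\<^sup>2 + q1\<^sup>2 + q2\<^sup>2 = 1 \<and> \<Omega> = rotation_of q0 q1 q2"
  then show "quadratic_form J (skew_vec (\<Omega> ** J - J ** transpose \<Omega>)) = 4 * quartic_H J q0 q1 q2"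
    using quadratic_form_eq_quartic_H by blast
qed (fact momentum_integral_quadratic_form parameter_integral_quartic_H)+

end
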